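(* Let $T=(V,E)$ be a rooted tree on $n$ vertices and let $\mathbf{a}\in\mathbb{R}^n_{\ge 0}$ be a vector of target values. Run the following algorithm (Push-Improve). Process the vertices $v$ of $T$ in post-order (children before parents). For the current vertex $v$, first set $x_v=\max\{\sum_{u\in C(v)}x_u,\ a_v\}$ (so a leaf gets $x_v=a_v$). Then, as long as there exist a path $P=(v=v_1,v_2,\dots,v_k)$ going down from $v$ (each $v_{i}\in C(v_{i-1})$) ending at a vertex $v_k$ that is either a leaf or satisfies $x_{v_k}>\sum_{w\in C(v_k)}x_w$, and a real $\epsilon>0$, such that $\mathrm{PushPath}(\mathbf{x},P,\epsilon)=\epsilon$, perform $\mathrm{PushPath}(\mathbf{x},P,\epsilon)$. Here $\mathrm{PushPath}(\mathbf{x},P,\epsilon)$ modifies $\mathbf{x}$ as follows: record $old=\sum_{i=1}^k|x_{v_i}-a_{v_i}|$; set $x_{v_1}\leftarrow x_{v_1}-\epsilon$; then for $i=2,\dots,k$ in order, let $t=\sum_{u\in C(v_{i-1})}x_u-x_{v_{i-1}}$ and, if $t>0$, set $x_{v_i}\leftarrow x_{v_i}-t$; finally return $old-\sum_{i=1}^k|x_{v_i}-a_{v_i}|$. Then, when the algorithm terminates, the obtained vector $\mathbf{x}$ is a feasible and optimal assignment for $T$, i.e. $\mathbf{x}\in\mathbb{R}^n_{\ge0}$, $x_v\ge\sum_{u\in C(v)}x_u$ for every vertex $v$, and $\|\mathbf{x}-\mathbf{a}\|_1$ is minimum among all vectors satisfying these constraints.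
   Context: Sum-Based Hierarchical Smoothing problem (SBHSP) under the $\ell_1$-norm on a rooted tree: for a vertex $u$, $C(u)$ denotes the set of children of $u$. A vector $\mathbf{x}\in\mathbb{R}^n_{\ge0}$ is feasible if for every vertex $v$ with children $u_1,\dots,u_k$ we have $x_v\ge x_{u_1}+\dots+x_{u_k}$. The goal is to find a feasible $\mathbf{x}$ minimizing $\|\mathbf{x}-\mathbf{a}\|_1=\sum_v|x_v-a_v|$.
   Formalization: A push along P with amount ε is allowed (and counted in the loop's exit test) only if afterwards x at the end vertex v_k is still at least the sum over its children (at least 0 for a leaf); without this the algorithm can stop at an infeasible vector. *)

theory Defs
  imports Complex_Main
begin

text \<open>
  A rooted tree is given by its parent-child edges: \<open>(u, v) \<in> E\<close> means that \<open>v\<close> is a child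
  of \<open>u\<close>.  A vector in \<open>\<real>\<^sup>n\<close> with \<open>n = card V\<close> is a function \<open>'v \<Rightarrow> real\<close>, of which only the
  values on \<open>V\<close> matter.
\<close>

definition rooted_tree :: "'v set \<Rightarrow> ('v \<times> 'v) set \<Rightarrow> 'v \<Rightarrow> bool" where
  "rooted_tree V E r \<longleftrightarrow>
     finite V \<and> r \<in> V \<and> E \<subseteq> V \<times> V \<and>
     (\<forall>u. (u, r) \<notin> E) \<and>
     (\<forall>v\<in>V - {r}. \<exists>!u. (u, v) \<in> E) \<and>
     (\<forall>v\<in>V. (r, v) \<in> E\<^sup>*)"

definition children :: "('v \<times> 'v) set \<Rightarrow> 'v \<Rightarrow> 'v set" where
  "children E u = {w. (u, w) \<in> E}"

definition child_sum :: "('v \<times> 'v) set \<Rightarrow> ('v \<Rightarrow> real) \<Rightarrow> 'v \<Rightarrow> real" where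
  "child_sum E x u = (\<Sum>w\<in>children E u. x w)"

definition feasible :: "'v set \<Rightarrow> ('v \<times> 'v) set \<Rightarrow> ('v \<Rightarrow> real) \<Rightarrow> bool" where
  "feasible V E x \<longleftrightarrow> (\<forall>v\<in>V. 0 \<le> x v) \<and> (\<forall>v\<in>V. child_sum E x v \<le> x v)"

definition l1_dist :: "'v set \<Rightarrow> ('v \<Rightarrow> real) \<Rightarrow> ('v \<Rightarrow> real) \<Rightarrow> real" where
  "l1_dist V x a = (\<Sum>v\<in>V. \<bar>x v - a v\<bar>)"

definition optimal :: "'v set \<Rightarrow> ('v \<times> 'v) set \<Rightarrow> ('v \<Rightarrow> real) \<Rightarrow> ('v \<Rightarrow> real) \<Rightarrow> bool" where
  "optimal V E a x \<longleftrightarrow>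
     feasible V E x \<and> (\<forall>y. feasible V E y \<longrightarrow> l1_dist V x a \<le> l1_dist V y a)"

text \<open>Any enumeration listing children before their parents; traversal post-orders are such.\<close>

definition post_order :: "'v set \<Rightarrow> ('v \<times> 'v) set \<Rightarrow> 'v list \<Rightarrow> bool" where
  "post_order V E vs \<longleftrightarrow>
     distinct vs \<and> set vs = V \<and>
     (\<forall>i<length vs. \<forall>j<length vs. (vs ! i, vs ! j) \<in> E \<longrightarrow> j < i)"

definition down_path :: "('v \<times> 'v) set \<Rightarrow> 'v \<Rightarrow> 'v list \<Rightarrow> bool" where
  "down_path E v P \<longleftrightarrow>
     P \<noteq> [] \<and> hd P = v \<and> (\<forall>i. Suc i < length P \<longrightarrow> P ! Suc i \<in> children E (P ! i))"

text \<open>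
  PushPath has an effect on the vector (\<open>push_path\<close>) and a return value (\<open>push_path_gain\<close>).
  The vertices of a downward path in a tree are distinct, so summing over the list is the
  sum over the path.
\<close>

fun push_down :: "('v \<times> 'v) set \<Rightarrow> 'v list \<Rightarrow> ('v \<Rightarrow> real) \<Rightarrow> ('v \<Rightarrow> real)" where
  "push_down E (p # q # P) x =
     (let t = child_sum E x p - x p
      in push_down E (q # P) (if t > 0 then x(q := x q - t) else x))"
| "push_down E [p] x = x"
| "push_down E [] x = x"

definition push_path :: "('v \<times> 'v) set \<Rightarrow> ('v \<Rightarrow> real) \<Rightarrow> 'v list \<Rightarrow> real \<Rightarrow> ('v \<Rightarrow> real)" where
  "push_path E x P \<epsilon> = push_down E P (x(hd P := x (hd P) - \<epsilon>))"

definition push_path_gain ::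
    "('v \<times> 'v) set \<Rightarrow> ('v \<Rightarrow> real) \<Rightarrow> ('v \<Rightarrow> real) \<Rightarrow> 'v list \<Rightarrow> real \<Rightarrow> real" where
  "push_path_gain E a x P \<epsilon> =
     (\<Sum>p\<leftarrow>P. \<bar>x p - a p\<bar>) - (\<Sum>p\<leftarrow>P. \<bar>push_path E x P \<epsilon> p - a p\<bar>)"

text \<open>
  One iteration of the loop at \<open>v\<close>.  The last conjunct makes explicit that \<open>\<epsilon>\<close> must be small
  enough for the end vertex to absorb the push: its own constraint still holds afterwards
  (for a leaf: its value stays nonnegative).  PushPath repairs the constraints at the earlier
  path vertices but never checks the one at the end, so without this condition the loop can
  produce infeasible vectors.  For example, on the path \<open>1, 2, 3, 4\<close> rooted at \<open>1\<close> with
  targets \<open>0, 0, 11, 10\<close>, processing \<open>1\<close> starts from \<open>(11, 11, 11, 10)\<close>; pushing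
  \<open>\<epsilon> = 5\<close> along \<open>1, 2, 3\<close> gains exactly \<open>5\<close> but yields \<open>(6, 6, 6, 10)\<close>, where the loop stops.
  With a root \<open>1\<close>, its only child \<open>2\<close>, two leaves \<open>3, 4\<close> below \<open>2\<close> and targets \<open>0, 0, 0, 5\<close>,
  pushing any \<open>\<epsilon> \<le> 5\<close> from \<open>(5, 5, 0, 5)\<close> along \<open>1, 2, 3\<close> gains \<open>\<epsilon>\<close> but makes leaf \<open>3\<close> negative.
\<close>

definition push_step ::
    "('v \<times> 'v) set \<Rightarrow> ('v \<Rightarrow> real) \<Rightarrow> 'v \<Rightarrow> ('v \<Rightarrow> real) \<Rightarrow> ('v \<Rightarrow> real) \<Rightarrow> bool" where
  "push_step E a v x x' \<longleftrightarrow>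
     (\<exists>P \<epsilon>. down_path E v P \<and>
        (children E (last P) = {} \<or> x (last P) > child_sum E x (last P)) \<and>
        \<epsilon> > 0 \<and> push_path_gain E a x P \<epsilon> = \<epsilon> \<and>
        x' = push_path E x P \<epsilon> \<and>
        child_sum E x' (last P) \<le> x' (last P))"

definition process_vertex ::
    "('v \<times> 'v) set \<Rightarrow> ('v \<Rightarrow> real) \<Rightarrow> 'v \<Rightarrow> ('v \<Rightarrow> real) \<Rightarrow> ('v \<Rightarrow> real) \<Rightarrow> bool" where
  "process_vertex E a v x x' \<longleftrightarrow>
     (push_step E a v)\<^sup>*\<^sup>* (x(v := max (child_sum E x v) (a v))) x' \<and>
     \<not> (\<exists>x''. push_step E a v x' x'')"

text \<open>
  \<open>push_improve E a vs x x'\<close>: starting from \<open>x\<close>, some terminating execution that processes the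
  vertices in the order \<open>vs\<close>, with arbitrary choices of paths and amounts, ends in \<open>x'\<close>.
\<close>

inductive push_improve ::
    "('v \<times> 'v) set \<Rightarrow> ('v \<Rightarrow> real) \<Rightarrow> 'v list \<Rightarrow> ('v \<Rightarrow> real) \<Rightarrow> ('v \<Rightarrow> real) \<Rightarrow> bool"
  for E a where
  Nil: "push_improve E a [] x x"
| Cons: "process_vertex E a v x y \<Longrightarrow> push_improve E a vs y z \<Longrightarrow> push_improve E a (v # vs) x z"

end

theory Submission
  imports Defs
begin

text \<open>
  While \<open>v\<close> is processed, the subtrees of its children stay optimal: a push by \<open>\<epsilon>\<close> gains at most
  \<open>\<epsilon>\<close> at \<open>v\<close> and, by optimality, nothing below \<open>v\<close>, so a gain of exactly \<open>\<epsilon>\<close> means that nothing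
  is lost below \<open>v\<close> and that \<open>x v\<close> does not fall below \<open>a v\<close>.

  Suppose that no push is possible and let \<open>y\<close> be feasible on the subtree of \<open>v\<close> and cheaper
  than \<open>x\<close>.  Then \<open>y v < x v\<close>, and feasibility yields a downward path on which \<open>y < x\<close>, ending at
  the first vertex where the constraint for \<open>x\<close> is slack.  A small push of \<open>x\<close> along this path
  gains an integer multiple \<open>k \<epsilon>\<close>, where \<open>k \<le> 1\<close> as above and
  \<open>k \<noteq> 1\<close> because no push is possible, so \<open>k \<le> 0\<close>.  By convexity, raising \<open>y\<close> along the path until it meets \<open>x\<close> at some vertex does not increase the cost of \<open>y\<close>.
  Iterating makes \<open>y\<close> agree with \<open>x\<close>, a contradiction.
\<close>

section \<open>Subtrees and downward paths\<close>

definition subtree :: "('v \<times> 'v) set \<Rightarrow> 'v \<Rightarrow> 'v set" where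
  "subtree E u = E\<^sup>* `` {u}"

lemma self_in_subtree: "u \<in> subtree E u"
  by (simp add: subtree_def)

lemma subtree_closed: "w \<in> subtree E u \<Longrightarrow> children E w \<subseteq> subtree E u"
  by (auto simp: subtree_def children_def)

lemma subtree_unfold: "subtree E u = insert u (\<Union>c\<in>children E u. subtree E c)"
  unfolding subtree_def children_def
proof (intro equalityI subsetI)
  fix w assume "w \<in> E\<^sup>* `` {u}"
  then have "(u, w) \<in> E\<^sup>*" by simp
  then show "w \<in> insert u (\<Union>c\<in>{w. (u, w) \<in> E}. E\<^sup>* `` {c})"
    by (cases rule: converse_rtranclE) auto
qed (auto intro: converse_rtrancl_into_rtrancl)

lemma child_subtree: "c \<in> children E u \<Longrightarrow> subtree E c \<subseteq> subtree E u"
  using subtree_unfold[of E u] by blast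

lemma down_path_single: "down_path E v [p] \<longleftrightarrow> p = v"
  by (auto simp: down_path_def)

lemma down_path_Cons:
  "down_path E v (p # q # P) \<longleftrightarrow> p = v \<and> q \<in> children E v \<and> down_path E q (q # P)"
  by (auto simp: down_path_def nth_Cons split: nat.splits)

lemma down_path_induct [consumes 1, case_names single Cons]:
  assumes "down_path E v P"
    and "\<And>v. Q v [v]"
    and "\<And>v q P. \<lbrakk>q \<in> children E v; down_path E q (q # P); Q q (q # P)\<rbrakk> \<Longrightarrow> Q v (v # q # P)"
  shows "Q v P"
  using assms(1)
proof (induction P arbitrary: v)
  case Nil
  then show ?case by (simp add: down_path_def)
next
  case (Cons p P)
  show ?case
  proof (cases P)
    case Nil
    then show ?thesis using Cons.prems assms(2) by (simp add: down_path_single)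
  next
    case (Cons q R)
    then show ?thesis using Cons.prems Cons.IH assms(3) by (auto simp: down_path_Cons)
  qed
qed

lemma down_path_subtree: "down_path E v P \<Longrightarrow> set P \<subseteq> subtree E v"
proof (induction rule: down_path_induct)
  case (Cons v q P)
  then show ?case using child_subtree[OF Cons.hyps(1)] self_in_subtree[of v E] by auto
qed (simp add: self_in_subtree)

section \<open>Locality and monotonicity of child sums, feasibility and optimality\<close>

lemma child_sum_cong:
  "(\<And>w. w \<in> children E u \<Longrightarrow> x w = y w) \<Longrightarrow> child_sum E x u = child_sum E y u"
  by (simp add: child_sum_def)

lemma child_sum_mono:
  "(\<And>w. w \<in> children E u \<Longrightarrow> x w \<le> y w) \<Longrightarrow> child_sum E x u \<le> child_sum E y u"
  by (simp add: child_sum_def sum_mono)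

lemma l1_dist_cong: "(\<And>w. w \<in> D \<Longrightarrow> x w = y w) \<Longrightarrow> l1_dist D x a = l1_dist D y a"
  by (simp add: l1_dist_def)

lemma feasible_subset: "feasible D E x \<Longrightarrow> D' \<subseteq> D \<Longrightarrow> feasible D' E x"
  by (auto simp: feasible_def)

lemma feasible_subtree_cong:
  assumes "\<And>w. w \<in> subtree E u \<Longrightarrow> x w = y w"
  shows "feasible (subtree E u) E x \<longleftrightarrow> feasible (subtree E u) E y"
proof -
  have "child_sum E x w = child_sum E y w" if "w \<in> subtree E u" for w
    using assms subtree_closed[OF that] by (intro child_sum_cong) blast
  then show ?thesis using assms by (simp add: feasible_def)
qed

lemma optimal_subtree_cong:
  assumes "\<And>w. w \<in> subtree E u \<Longrightarrow> x w = y w" and "optimal (subtree E u) E a x"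
  shows "optimal (subtree E u) E a y"
  using assms feasible_subtree_cong[of E u x y] l1_dist_cong[of "subtree E u" x y a]
  by (simp add: optimal_def)

section \<open>Effect of PushPath on the vector, and slopes of the absolute value\<close>

lemma push_down_le: "push_down E P x w \<le> x w"
proof (induction E P x rule: push_down.induct)
  case (1 E p q P x)
  define t where "t = child_sum E x p - x p"
  have "push_down E (q # P) (if t > 0 then x(q := x q - t) else x) w
      \<le> (if t > 0 then x(q := x q - t) else x) w"
    by (rule "1.IH") (simp add: t_def)
  also have "\<dots> \<le> x w" by simp
  finally show ?case unfolding t_def by (simp only: push_down.simps Let_def)
qed simp_all

text \<open>Each round of \<open>push_down\<close> updates only the second vertex of the current
  list, so the head keeps its value as well; hence \<open>tl P\<close>.\<close>

lemma push_down_outside: "w \<notin> set (tl P) \<Longrightarrow> push_down E P x w = x w"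
  by (induction E P x rule: push_down.induct) (auto simp: Let_def)

definition shift_on :: "'v set \<Rightarrow> real \<Rightarrow> ('v \<Rightarrow> real) \<Rightarrow> 'v \<Rightarrow> real" where
  "shift_on S \<theta> x w = (if w \<in> S then x w + \<theta> else x w)"

text \<open>Convexity of the distance to \<open>a\<close>, cross-multiplied to avoid division. The
  last hypothesis keeps the step down from \<open>x\<close> from crossing \<open>a\<close>, so its
  slope is the left derivative at \<open>x\<close>, which bounds all slopes further left.\<close>

lemma abs_slope_mono:
  fixes x y a \<theta> \<epsilon> :: real
  assumes "y + \<theta> \<le> x" "0 < \<epsilon>" "0 < \<theta>" "x > a \<longrightarrow> \<epsilon> \<le> x - a"
  shows "(\<bar>y + \<theta> - a\<bar> - \<bar>y - a\<bar>) * \<epsilon> \<le> (\<bar>x - a\<bar> - \<bar>x - \<epsilon> - a\<bar>) * \<theta>"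
proof (cases "x > a")
  case True
  then have "\<bar>x - a\<bar> - \<bar>x - \<epsilon> - a\<bar> = \<epsilon>" using assms by auto
  moreover have "(\<bar>y + \<theta> - a\<bar> - \<bar>y - a\<bar>) * \<epsilon> \<le> \<theta> * \<epsilon>"
    using assms by (intro mult_right_mono) auto
  ultimately show ?thesis by (simp add: mult.commute)
next
  case False
  then have "\<bar>x - a\<bar> - \<bar>x - \<epsilon> - a\<bar> = - \<epsilon>" "\<bar>y + \<theta> - a\<bar> - \<bar>y - a\<bar> = - \<theta>"
    using assms by auto
  then show ?thesis by simp
qed

lemma small_step_exists:
  fixes f g :: "'v \<Rightarrow> real"
  assumes "finite S" "0 < s"
  obtains \<epsilon> where "0 < \<epsilon>" "\<epsilon> \<le> s" "\<And>w. w \<in> S \<Longrightarrow> f w > g w \<longrightarrow> \<epsilon> \<le> f w - g w"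
proof -
  define M where "M = insert s ((\<lambda>w. f w - g w) ` {w\<in>S. f w > g w})"
  have M: "finite M" "M \<noteq> {}" "\<forall>m\<in>M. 0 < m" using assms by (auto simp: M_def)
  show thesis
  proof (rule that[of "Min M"])
    show "0 < Min M" using M by simp
    show "Min M \<le> s" using M(1) by (simp add: M_def)
    show "f w > g w \<longrightarrow> Min M \<le> f w - g w" if "w \<in> S" for w
      using that M(1) by (auto intro!: Min_le simp: M_def)
  qed
qed

section \<open>Structure of finite forests\<close>

locale finite_forest =
  fixes E :: "('v \<times> 'v) set"
  assumes finite_edges: "finite E"
    and acyclic_edges: "acyclic E"
    and unique_parent: "\<lbrakk>(u, w) \<in> E; (u', w) \<in> E\<rbrakk> \<Longrightarrow> u = u'"
begin

lemma finite_children: "finite (children E u)"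
proof -
  have "children E u \<subseteq> snd ` E" by (force simp: children_def)
  then show ?thesis using finite_edges finite_surj by blast
qed

text \<open>Induction from the leaves upwards: a finite acyclic relation has a well-founded
  converse.\<close>

lemma forest_induct: "(\<And>u. (\<And>c. c \<in> children E u \<Longrightarrow> Q c) \<Longrightarrow> Q u) \<Longrightarrow> Q u"
  using wf_induct_rule[of "E\<inverse>" Q u] finite_acyclic_wf_converse[OF finite_edges acyclic_edges]
  by (auto simp: children_def)

lemma finite_subtree: "finite (subtree E u)"
  by (induction u rule: forest_induct) (subst subtree_unfold, simp add: finite_children)

lemma not_in_child_subtree: "c \<in> children E u \<Longrightarrow> u \<notin> subtree E c"
  using acyclic_edges rtrancl_into_trancl2[of u c E u]
  by (auto simp: children_def subtree_def acyclic_def)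

lemma not_child_of_descendant: "w \<in> subtree E u \<Longrightarrow> u \<notin> children E w"
  using acyclic_edges rtrancl_into_trancl1[of u w E u]
  by (auto simp: children_def subtree_def acyclic_def)

lemma parent_in_subtree:
  assumes "w \<in> subtree E u" "w \<noteq> u" "(p, w) \<in> E"
  shows "p \<in> subtree E u"
proof -
  obtain p' where "(u, p') \<in> E\<^sup>*" "(p', w) \<in> E"
    using assms(1,2) rtranclE[of u w E] by (auto simp: subtree_def)
  moreover from this have "p' = p" using assms(3) unique_parent by blast
  ultimately show ?thesis by (simp add: subtree_def)
qed

text \<open>Parents are unique, so the ancestors of \<open>w\<close> form a chain. The induction
  follows the path from \<open>u\<close> and compares its last edge with that of the path from
  \<open>u'\<close>.\<close>

lemma subtrees_nested:
  assumes "w \<in> subtree E u" "w \<in> subtree E u'"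
  shows "u \<in> subtree E u' \<or> u' \<in> subtree E u"
proof -
  have "(u, w) \<in> E\<^sup>*" "(u', w) \<in> E\<^sup>*" using assms by (auto simp: subtree_def)
  then have "(u', u) \<in> E\<^sup>* \<or> (u, u') \<in> E\<^sup>*"
  proof (induction rule: rtrancl_induct)
    case (step p w)
    from step.prems show ?case
    proof (cases rule: rtranclE)
      case base
      then show ?thesis using step.hyps by (meson rtrancl.rtrancl_into_rtrancl)
    next
      case (step p')
      then show ?thesis using unique_parent \<open>(p, w) \<in> E\<close> \<open>(u', p) \<in> E\<^sup>* \<Longrightarrow> _\<close> by metis
    qed
  qed simp
  then show ?thesis by (auto simp: subtree_def)
qed

text \<open>Overlapping subtrees are nested, and a child lying below its sibling would put the
  common parent below that sibling, closing a cycle.\<close>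

lemma child_subtrees_disjoint:
  assumes "c \<in> children E u" "c' \<in> children E u" "c \<noteq> c'"
  shows "subtree E c \<inter> subtree E c' = {}"
proof -
  have "c \<notin> subtree E c'" if "c \<in> children E u" "c' \<in> children E u" "c \<noteq> c'" for c c'
    using that parent_in_subtree[of c c' u] not_in_child_subtree[of c' u]
    by (auto simp: children_def)
  then show ?thesis using assms subtrees_nested by blast
qed

lemma l1_dist_subtree:
  "l1_dist (subtree E v) x a = \<bar>x v - a v\<bar> + (\<Sum>c\<in>children E v. l1_dist (subtree E c) x a)"
proof -
  have "(\<Sum>w\<in>(\<Union>c\<in>children E v. subtree E c). \<bar>x w - a w\<bar>)
      = (\<Sum>c\<in>children E v. \<Sum>w\<in>subtree E c. \<bar>x w - a w\<bar>)"
    using child_subtrees_disjoint[of _ v]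
    by (intro sum.UNION_disjoint) (auto simp: finite_children finite_subtree)
  moreover have "v \<notin> (\<Union>c\<in>children E v. subtree E c)" using not_in_child_subtree by blast
  ultimately show ?thesis
    unfolding l1_dist_def by (subst subtree_unfold) (simp add: finite_children finite_subtree)
qed

text \<open>Nonnegativity follows from the child constraints, from the leaves upwards: the empty
  child sum of a leaf is 0.\<close>

lemma feasible_subtreeI:
  assumes "\<And>w. w \<in> subtree E u \<Longrightarrow> child_sum E x w \<le> x w"
  shows "feasible (subtree E u) E x"
proof -
  have "0 \<le> x w" if "w \<in> subtree E u" for w
    using that
  proof (induction w rule: forest_induct)
    case (1 w)
    then have "0 \<le> child_sum E x w"
      using subtree_closed[of w E u] by (auto simp: child_sum_def intro!: sum_nonneg)
    then show ?case using assms[OF 1(2)] by simp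
  qed
  then show ?thesis using assms by (simp add: feasible_def)
qed

section \<open>Pushes and shifts along a path\<close>

lemma down_path_distinct: "down_path E v P \<Longrightarrow> distinct P"
proof (induction rule: down_path_induct)
  case (Cons v q P)
  then show ?case using down_path_subtree[OF Cons.hyps(2)] not_in_child_subtree[OF Cons.hyps(1)]
    by auto
qed simp

text \<open>Links the return value of PushPath, which sees only the path, to the cost of the whole
  subtree.\<close>

lemma l1_dist_path_diff:
  assumes "down_path E v P" "\<And>w. w \<notin> set P \<Longrightarrow> x' w = x w"
  shows "l1_dist (subtree E v) x a - l1_dist (subtree E v) x' a
    = (\<Sum>w\<in>set P. \<bar>x w - a w\<bar> - \<bar>x' w - a w\<bar>)"
  unfolding l1_dist_def sum_subtractf[symmetric]
  using down_path_subtree[OF assms(1)] assms(2)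
  by (intro sum.mono_neutral_right) (auto simp: finite_subtree)

lemma push_path_gain_eq:
  "down_path E v P \<Longrightarrow>
    push_path_gain E a x P \<epsilon> = (\<Sum>w\<in>set P. \<bar>x w - a w\<bar> - \<bar>push_path E x P \<epsilon> w - a w\<bar>)"
  by (simp add: push_path_gain_def sum_subtractf sum_list_distinct_conv_sum_set down_path_distinct)

text \<open>Lowering the next path vertex by the deficit repairs the constraint at the current one.
  Later rounds leave the current value alone and only lower others, so the repair persists.\<close>

lemma push_down_repairs:
  assumes "down_path E v P" "p \<in> set P" "p \<noteq> last P"
  shows "child_sum E (push_down E P x) p \<le> push_down E P x p"
  using assms
proof (induction arbitrary: x rule: down_path_induct)
  case (Cons v q P)
  define t where "t = child_sum E x v - x v"
  define x1 where "x1 = (if t > 0 then x(q := x q - t) else x)"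
  have pd: "push_down E (v # q # P) x = push_down E (q # P) x1"
    by (simp add: x1_def t_def Let_def)
  show ?case
  proof (cases "p = v")
    case True
    have nq: "v \<notin> set (q # P)"
      using down_path_subtree[OF Cons.hyps(2)] not_in_child_subtree[OF Cons.hyps(1)] by blast
    then have "push_down E (q # P) x1 v = x1 v" by (intro push_down_outside) simp
    moreover have "x1 v = x v" using nq by (simp add: x1_def)
    moreover have "child_sum E (push_down E (q # P) x1) v \<le> child_sum E x1 v"
      by (intro child_sum_mono push_down_le)
    moreover have "child_sum E x1 v \<le> x v"
    proof (cases "t > 0")
      case True
      have "child_sum E (x(q := x q - t)) v = child_sum E x v - t"
        using Cons.hyps(1) by (simp add: child_sum_def sum.remove[OF finite_children])
      then show ?thesis using True by (simp add: x1_def t_def)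
    qed (simp add: x1_def t_def)
    ultimately show ?thesis using True pd by simp
  next
    case False
    then show ?thesis using Cons pd by simp
  qed
qed simp

text \<open>Within the subtree, the parent of a path vertex is its predecessor on the path, and
  \<open>v\<close> has no parent there. So a path vertex before the last has exactly one child on
  the path, and any other vertex has none.\<close>

lemma child_sum_shift:
  assumes "down_path E v P" "w \<in> subtree E v"
  shows "child_sum E (shift_on (set P) \<theta> x) w
    = child_sum E x w + (if w \<in> set P \<and> w \<noteq> last P then \<theta> else 0)"
proof -
  have *: "children E w \<inter> set P = {}" if "w \<notin> set P \<or> w = last P"
    using assms that
  proof (induction rule: down_path_induct)
    case (single v)
    then show ?case using not_child_of_descendant by auto
  next
    case (Cons v q P)
    have nv: "v \<notin> children E w" using not_child_of_descendant Cons.prems by blast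
    have "children E w \<inter> set (q # P) = {}"
    proof (cases "w \<in> subtree E q")
      case True
      then show ?thesis using Cons.IH Cons.prems by auto
    next
      case False
      \<comment> \<open>A child in \<open>subtree E q\<close> of a vertex outside it can only be
        \<open>q\<close>, so \<open>w = v\<close>; then \<open>v\<close> would have to be the last
        path vertex, which lies in \<open>subtree E q\<close>.\<close>
      have "c \<notin> subtree E q" if c: "c \<in> children E w" for c
      proof
        assume "c \<in> subtree E q"
        then have "c = q" using False parent_in_subtree[of c q w] c by (auto simp: children_def)
        then have "w = v" using unique_parent[of w q v] c Cons.hyps(1) by (simp add: children_def)
        moreover have "last (v # q # P) \<in> subtree E q"
          using down_path_subtree[OF Cons.hyps(2)] by (auto split: if_splits)
        ultimately show False using Cons.prems False by auto
      qed
      then show ?thesis using down_path_subtree[OF Cons.hyps(2)] by blast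
    qed
    then show ?case using nv by simp
  qed
  have **: "\<exists>q. children E w \<inter> set P = {q}" if "w \<in> set P" "w \<noteq> last P"
    using assms(1) that
  proof (induction rule: down_path_induct)
    case (single v)
    then show ?case by auto
  next
    case (Cons v q P)
    show ?case
    proof (cases "w = v")
      case True
      have "c = q" if "c \<in> children E v" "c \<in> set (q # P)" for c
        using that child_subtrees_disjoint[of c v q] Cons.hyps self_in_subtree[of c E]
          down_path_subtree[OF Cons.hyps(2)] by blast
      moreover have "v \<notin> children E v" by (rule not_child_of_descendant[OF self_in_subtree])
      ultimately have "children E w \<inter> set (v # q # P) = {q}" using True Cons.hyps(1) by auto
      then show ?thesis by blast
    next
      case False
      then have w: "w \<in> set (q # P)" "w \<noteq> last (q # P)" using Cons.prems by auto
      then have "w \<in> subtree E v"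
        using down_path_subtree[OF Cons.hyps(2)] child_subtree[OF Cons.hyps(1)] by blast
      then have "v \<notin> children E w" by (rule not_child_of_descendant)
      then show ?thesis using Cons.IH[OF w] by simp
    qed
  qed
  have "child_sum E (shift_on (set P) \<theta> x) w
      = child_sum E x w + (\<Sum>c\<in>children E w. if c \<in> set P then \<theta> else 0)"
    unfolding child_sum_def sum.distrib[symmetric] by (intro sum.cong) (auto simp: shift_on_def)
  also have "(\<Sum>c\<in>children E w. if c \<in> set P then \<theta> else 0) = (\<Sum>c\<in>children E w \<inter> set P. \<theta>)"
    by (rule sum.inter_restrict[OF finite_children, symmetric])
  also have "\<dots> = (if w \<in> set P \<and> w \<noteq> last P then \<theta> else 0)"
    using * ** by (auto split: if_splits)
  finally show ?thesis .
qed

text \<open>At a path vertex before the last, both sides of the constraint move by \<theta>; off the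
  path neither moves. Only the end needs room.\<close>

lemma feasible_shift:
  assumes "down_path E v P" "feasible (subtree E v) E x"
    and "child_sum E x (last P) \<le> x (last P) + \<theta>"
  shows "feasible (subtree E v) E (shift_on (set P) \<theta> x)"
proof (rule feasible_subtreeI)
  fix w assume w: "w \<in> subtree E v"
  have "last P \<in> set P" using assms(1) by (auto simp: down_path_def)
  moreover have "child_sum E x w \<le> x w" using assms(2) w by (simp add: feasible_def)
  ultimately show "child_sum E (shift_on (set P) \<theta> x) w \<le> shift_on (set P) \<theta> x w"
    using child_sum_shift[OF assms(1) w] assms(3) by (auto simp: shift_on_def)
qed

text \<open>With tight constraints before the end, the deficit handed down is exactly \<epsilon> in
  every round, so the push is a uniform shift.\<close>

lemma push_path_tight:
  assumes "down_path E v P" "0 < \<epsilon>"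
    and "\<And>p. p \<in> set P \<Longrightarrow> p \<noteq> last P \<Longrightarrow> child_sum E x p = x p"
  shows "push_path E x P \<epsilon> = shift_on (set P) (- \<epsilon>) x"
  using assms
proof (induction arbitrary: x rule: down_path_induct)
  case (single v)
  then show ?case by (auto simp: push_path_def shift_on_def)
next
  case (Cons v q P)
  \<comment> \<open>The vector after the first update; what remains is a push of the same \<epsilon>
    from \<open>y\<close> along the rest of the path.\<close>
  define y where "y = x(v := x v - \<epsilon>)"
  have sub: "set (q # P) \<subseteq> subtree E q" using down_path_subtree[OF Cons.hyps(2)] .
  have nv: "v \<notin> set (q # P)" using sub not_in_child_subtree[OF Cons.hyps(1)] by blast
  have y: "child_sum E y p = child_sum E x p" if "p \<in> subtree E v" for p
    using not_child_of_descendant[OF that] by (intro child_sum_cong) (auto simp: y_def)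
  have "last (v # q # P) \<in> set (q # P)" by (auto split: if_splits)
  then have "child_sum E x v = x v" using Cons.prems(2)[of v] nv by auto
  then have t: "child_sum E y v - y v = \<epsilon>" using y[OF self_in_subtree] by (simp add: y_def)
  have "push_path E y (q # P) \<epsilon> = shift_on (set (q # P)) (- \<epsilon>) y"
  proof (rule Cons.IH[OF Cons.prems(1)])
    fix p assume p: "p \<in> set (q # P)" "p \<noteq> last (q # P)"
    then have "child_sum E x p = x p" using Cons.prems(2) by auto
    moreover have "p \<in> subtree E v" using p sub child_subtree[OF Cons.hyps(1)] by blast
    ultimately show "child_sum E y p = y p" using y p nv by (auto simp: y_def)
  qed
  moreover have "push_path E x (v # q # P) \<epsilon> = push_path E y (q # P) \<epsilon>"
    using t Cons.prems(1) by (simp add: push_path_def y_def[symmetric])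
  moreover have "shift_on (set (q # P)) (- \<epsilon>) y = shift_on (set (v # q # P)) (- \<epsilon>) x"
    using nv by (auto simp: shift_on_def y_def fun_eq_iff)
  ultimately show ?case by simp
qed

text \<open>Descend until \<open>x\<close> is slack. At a tight vertex the child sum of
  \<open>y\<close> is below that of \<open>x\<close>, so some child again has
  \<open>y c < x c\<close>; in particular a leaf cannot be tight.\<close>

lemma slack_path_exists:
  assumes "feasible (subtree E v) E x" "feasible (subtree E v) E y" "y v < x v"
  obtains P where "down_path E v P" "\<And>w. w \<in> set P \<Longrightarrow> y w < x w"
    "child_sum E x (last P) < x (last P)"
    "\<And>p. p \<in> set P \<Longrightarrow> p \<noteq> last P \<Longrightarrow> child_sum E x p = x p"
proof -
  have "\<exists>P. down_path E v P \<and> (\<forall>w\<in>set P. y w < x w) \<and> child_sum E x (last P) < x (last P)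
    \<and> (\<forall>p\<in>set P. p \<noteq> last P \<longrightarrow> child_sum E x p = x p)"
    using assms
  proof (induction v rule: forest_induct)
    case (1 v)
    show ?case
    proof (cases "child_sum E x v < x v")
      case True
      then show ?thesis using 1(4) by (intro exI[of _ "[v]"]) (simp add: down_path_single)
    next
      case False
      have "child_sum E x v \<le> x v" "child_sum E y v \<le> y v"
        using 1(2,3) self_in_subtree[of v E] by (auto simp: feasible_def)
      then have tight: "child_sum E x v = x v" and "child_sum E y v < child_sum E x v"
        using False 1(4) by auto
      then obtain c where c: "c \<in> children E v" "y c < x c"
        using child_sum_mono[of E v x y] by force
      obtain P where P: "down_path E c P" "\<forall>w\<in>set P. y w < x w"
        "child_sum E x (last P) < x (last P)"
        "\<forall>p\<in>set P. p \<noteq> last P \<longrightarrow> child_sum E x p = x p"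
        using 1(1)[OF c(1)] c 1(2,3) feasible_subset child_subtree by metis
      then obtain R where R: "P = c # R" by (cases P) (auto simp: down_path_def)
      show ?thesis using P c tight 1(4) unfolding R
        by (intro exI[of _ "v # c # R"]) (auto simp: down_path_Cons)
    qed
  qed
  then show thesis using that by blast
qed

section \<open>The loop at a single vertex\<close>

text \<open>No feasible vector is cheaper on the optimal child subtrees, so an improvement must come
  from \<open>v\<close>. This is applied both to pushed vectors and to arbitrary
  competitors.\<close>

lemma gain_le_root_gain:
  assumes "\<And>c. c \<in> children E v \<Longrightarrow> optimal (subtree E c) E a x"
    and "feasible (subtree E v) E y"
  shows "l1_dist (subtree E v) x a - l1_dist (subtree E v) y a \<le> \<bar>x v - a v\<bar> - \<bar>y v - a v\<bar>"
proof -
  have "l1_dist (subtree E c) x a \<le> l1_dist (subtree E c) y a" if "c \<in> children E v" for c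
    using assms(1)[OF that] feasible_subset[OF assms(2) child_subtree[OF that]]
    by (simp add: optimal_def)
  then have "(\<Sum>c\<in>children E v. l1_dist (subtree E c) x a)
      \<le> (\<Sum>c\<in>children E v. l1_dist (subtree E c) y a)" by (rule sum_mono)
  then show ?thesis by (simp add: l1_dist_subtree[of v])
qed

text \<open>The bound \<open>a v \<le> x v\<close> settles competitors with
  \<open>x v \<le> y v\<close>: they gain nothing at the root.\<close>

definition loop_invariant :: "('v \<Rightarrow> real) \<Rightarrow> 'v \<Rightarrow> ('v \<Rightarrow> real) \<Rightarrow> bool" where
  "loop_invariant a v x \<longleftrightarrow> feasible (subtree E v) E x
    \<and> (\<forall>c\<in>children E v. optimal (subtree E c) E a x) \<and> a v \<le> x v"

lemma push_step_outside:
  assumes "push_step E a v x x'" "w \<notin> subtree E v"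
  shows "x' w = x w"
proof -
  obtain P \<epsilon> where P: "down_path E v P" "x' = push_path E x P \<epsilon>"
    using assms(1) by (auto simp: push_step_def)
  then have "w \<notin> set P" using assms(2) down_path_subtree[OF P(1)] by blast
  then show ?thesis
    using P by (cases P) (auto simp: push_path_def push_down_outside down_path_def)
qed

lemma push_step_invariant:
  assumes "push_step E a v x x'" "loop_invariant a v x"
  shows "loop_invariant a v x'"
proof -
  obtain P \<epsilon> where P: "down_path E v P" and eps: "\<epsilon> > 0"
    and gain: "push_path_gain E a x P \<epsilon> = \<epsilon>" and x': "x' = push_path E x P \<epsilon>"
    and last: "child_sum E x' (last P) \<le> x' (last P)"
    using assms(1) by (auto simp: push_step_def)
  obtain R where R: "P = v # R" using P by (cases P) (auto simp: down_path_def)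
  have dist: "v \<notin> set R" using down_path_distinct[OF P] R by simp
  have feas: "feasible (subtree E v) E x"
    and opt: "\<And>c. c \<in> children E v \<Longrightarrow> optimal (subtree E c) E a x" and av: "a v \<le> x v"
    using assms(2) by (auto simp: loop_invariant_def)
  have le: "x' w \<le> x w" for w
    using push_down_le[of E P "x(v := x v - \<epsilon>)" w] eps
    by (auto simp: x' push_path_def R split: if_splits)
  have out: "x' w = x w" if "w \<notin> set P" for w
    using that push_down_outside[of w P] by (auto simp: x' push_path_def R)
  have v: "x' v = x v - \<epsilon>"
    using push_down_outside[of v P] dist by (simp add: x' push_path_def R)
  \<comment> \<open>Repairs cover the path vertices before the last, and \<open>push_step\<close>
    demands the constraint at the last. Off the path, values are unchanged and child sums can only
    fall.\<close>
  have feas': "feasible (subtree E v) E x'"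
  proof (rule feasible_subtreeI)
    fix w assume w: "w \<in> subtree E v"
    show "child_sum E x' w \<le> x' w"
    proof (cases "w \<in> set P")
      case True
      then show ?thesis using last push_down_repairs[OF P, of w]
        by (cases "w = last P") (auto simp: x' push_path_def)
    next
      case False
      have "child_sum E x' w \<le> child_sum E x w" by (intro child_sum_mono le)
      also have "\<dots> \<le> x w" using feas w by (simp add: feasible_def)
      finally show ?thesis using out[OF False] by simp
    qed
  qed
  have total: "l1_dist (subtree E v) x a - l1_dist (subtree E v) x' a = \<epsilon>"
    using l1_dist_path_diff[of v P x' x a] P out gain
    by (simp add: push_path_gain_eq[OF P] x')
  \<comment> \<open>All of \<epsilon> must be gained at the root, which is possible only if the
    value at \<open>v\<close> does not drop below its target.\<close>
  have root: "\<epsilon> \<le> \<bar>x v - a v\<bar> - \<bar>x v - \<epsilon> - a v\<bar>"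
    using gain_le_root_gain[of v a x x'] opt feas' total v by simp
  then have av': "a v \<le> x' v" using av eps v by (auto simp: abs_if split: if_splits)
  have childle: "l1_dist (subtree E c) x a \<le> l1_dist (subtree E c) x' a"
    if "c \<in> children E v" for c
    using opt[OF that] feasible_subset[OF feas' child_subtree[OF that]]
    by (simp add: optimal_def)
  \<comment> \<open>The root accounts for the whole gain, so the child costs agree in total; as none
    of them has decreased, they agree one by one.\<close>
  have "(\<Sum>c\<in>children E v. l1_dist (subtree E c) x a)
      = (\<Sum>c\<in>children E v. l1_dist (subtree E c) x' a)"
    using total v av av' by (simp add: l1_dist_subtree[of v])
  then have "l1_dist (subtree E c) x a = l1_dist (subtree E c) x' a" if "c \<in> children E v" for c
    using childle that finite_children by (rule sum_mono_inv)
  then have "optimal (subtree E c) E a x'" if "c \<in> children E v" for c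
    using that opt[OF that] feasible_subset[OF feas' child_subtree[OF that]]
    by (simp add: optimal_def)
  then show ?thesis using feas' av' by (simp add: loop_invariant_def)
qed

text \<open>The strictly shrinking set of disagreements with \<open>x\<close> is the measure for
  iterating the raise.\<close>

lemma raise_towards_stuck:
  assumes inv: "loop_invariant a v x" and stuck: "\<nexists>x'. push_step E a v x x'"
    and y: "feasible (subtree E v) E y" and less: "y v < x v"
  obtains y' where "feasible (subtree E v) E y'"
    "l1_dist (subtree E v) y' a \<le> l1_dist (subtree E v) y a"
    "{w \<in> subtree E v. x w \<noteq> y' w} \<subset> {w \<in> subtree E v. x w \<noteq> y w}"
proof -
  have feas: "feasible (subtree E v) E x"
    and opt: "\<And>c. c \<in> children E v \<Longrightarrow> optimal (subtree E c) E a x"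
    using inv by (auto simp: loop_invariant_def)
  obtain P where P: "down_path E v P" "\<And>w. w \<in> set P \<Longrightarrow> y w < x w"
    and slack: "child_sum E x (last P) < x (last P)"
    and tight: "\<And>p. p \<in> set P \<Longrightarrow> p \<noteq> last P \<Longrightarrow> child_sum E x p = x p"
    using slack_path_exists[OF feas y less] by metis
  have ne: "set P \<noteq> {}" "last P \<in> set P" "v \<in> set P"
    using P(1) by (auto simp: down_path_def)
  have sub: "set P \<subseteq> subtree E v" using down_path_subtree[OF P(1)] .
  \<comment> \<open>The largest raise keeping \<open>y\<close> below \<open>x\<close> on the path;
    it makes them meet at the minimizer \<open>m\<close>.\<close>
  define \<theta> where "\<theta> = Min ((\<lambda>w. x w - y w) ` set P)"
  have \<theta>_le: "y w + \<theta> \<le> x w" if "w \<in> set P" for w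
  proof -
    have "\<theta> \<le> x w - y w" unfolding \<theta>_def using that by (intro Min_le) auto
    then show ?thesis by simp
  qed
  have "\<theta> \<in> (\<lambda>w. x w - y w) ` set P" unfolding \<theta>_def using ne by (intro Min_in) auto
  then obtain m where m: "m \<in> set P" "\<theta> = x m - y m" by blast
  have \<theta>_pos: "0 < \<theta>" using m P(2) by simp
  \<comment> \<open>Small enough for the slack at the end and for no value to cross its target, so
    every distance on the path changes by exactly \<epsilon>.\<close>
  obtain \<epsilon> where eps: "0 < \<epsilon>" "\<epsilon> \<le> x (last P) - child_sum E x (last P)"
    and eps_a: "\<And>w. w \<in> set P \<Longrightarrow> x w > a w \<longrightarrow> \<epsilon> \<le> x w - a w"
    using small_step_exists[of "set P" "x (last P) - child_sum E x (last P)" a x] slack by auto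
  define x' where "x' = shift_on (set P) (- \<epsilon>) x"
  have x': "push_path E x P \<epsilon> = x'"
    unfolding x'_def using push_path_tight[OF P(1) eps(1)] tight by blast
  have feas': "feasible (subtree E v) E x'"
    unfolding x'_def using feasible_shift[OF P(1) feas] eps by simp
  \<comment> \<open>Path vertices above their target minus the others. Integrality will turn
    \<open>k \<le> 1\<close> and \<open>k \<noteq> 1\<close> into \<open>k \<le> 0\<close>.\<close>
  define k :: int where "k = (\<Sum>w\<in>set P. if x w > a w then 1 else - 1)"
  define G where "G = (\<Sum>w\<in>set P. \<bar>x w - a w\<bar> - \<bar>x w - \<epsilon> - a w\<bar>)"
  have G: "G = k * \<epsilon>"
    unfolding G_def k_def of_int_sum sum_distrib_right
    using eps_a eps(1) by (intro sum.cong) (force simp: abs_if)+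
  have gain: "push_path_gain E a x P \<epsilon> = G"
    by (simp add: push_path_gain_eq[OF P(1)] x' G_def x'_def shift_on_def)
  have "l1_dist (subtree E v) x a - l1_dist (subtree E v) x' a = G"
    using l1_dist_path_diff[OF P(1), of x' x a] by (simp add: G_def x'_def shift_on_def)
  moreover have "l1_dist (subtree E v) x a - l1_dist (subtree E v) x' a
      \<le> \<bar>x v - a v\<bar> - \<bar>x' v - a v\<bar>" using gain_le_root_gain[OF opt feas'] .
  moreover have "x' v = x v - \<epsilon>" using ne by (simp add: x'_def shift_on_def)
  moreover have "\<bar>x v - a v\<bar> - \<bar>x v - \<epsilon> - a v\<bar> \<le> \<epsilon>" using eps(1) by linarith
  ultimately have "k * \<epsilon> \<le> 1 * \<epsilon>" using G by linarith
  then have "k \<le> 1" using eps(1) by simp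
  \<comment> \<open>Otherwise this push would be an admissible loop step.\<close>
  moreover have "G \<noteq> \<epsilon>"
  proof
    assume "G = \<epsilon>"
    moreover have "child_sum E x' (last P) \<le> x' (last P)"
      using feas' subsetD[OF sub ne(2)] by (simp add: feasible_def)
    ultimately have "push_step E a v x x'"
      unfolding push_step_def using P(1) slack eps gain x'
      by (intro exI[of _ P] exI[of _ \<epsilon>]) simp
    then show False using stuck by blast
  qed
  then have "k \<noteq> 1" using G by auto
  ultimately have "k \<le> 0" by simp
  then have "G * \<theta> \<le> 0" using G eps(1) \<theta>_pos by (simp add: mult_nonpos_nonneg)
  define y' where "y' = shift_on (set P) \<theta> y"
  have "child_sum E y (last P) \<le> y (last P)" 
    using y subsetD[OF sub ne(2)] by (simp add: feasible_def)
  then have 1: "feasible (subtree E v) E y'"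
    unfolding y'_def using feasible_shift[OF P(1) y] \<theta>_pos by simp
  \<comment> \<open>Convexity summed over the path: the cost slope of raising \<open>y\<close> is at
    most \<open>G / \<epsilon>\<close>, which is nonpositive.\<close>
  have "(\<Sum>w\<in>set P. \<bar>y w + \<theta> - a w\<bar> - \<bar>y w - a w\<bar>) * \<epsilon> \<le> G * \<theta>"
    unfolding G_def sum_distrib_right
    by (intro sum_mono abs_slope_mono \<theta>_le eps \<theta>_pos eps_a)
  with \<open>G * \<theta> \<le> 0\<close> have "(\<Sum>w\<in>set P. \<bar>y w + \<theta> - a w\<bar> - \<bar>y w - a w\<bar>) \<le> 0"
    using eps(1) by (meson mult_pos_pos not_le order_trans)
  then have 2: "l1_dist (subtree E v) y' a \<le> l1_dist (subtree E v) y a"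
    using l1_dist_path_diff[OF P(1), of y' y a]
    by (simp add: y'_def shift_on_def sum_subtractf)
  \<comment> \<open>The raise acts only where \<open>y < x\<close>, so it creates no disagreement,
    and it removes the one at \<open>m\<close>.\<close>
  have "x w \<noteq> y w" if "x w \<noteq> y' w" for w
    using that P(2)[of w] by (cases "w \<in> set P") (auto simp: y'_def shift_on_def)
  then have "{w \<in> subtree E v. x w \<noteq> y' w} \<subseteq> {w \<in> subtree E v. x w \<noteq> y w}"
    by blast
  moreover have "m \<in> {w \<in> subtree E v. x w \<noteq> y w}" "m \<notin> {w \<in> subtree E v. x w \<noteq> y' w}"
    using m P(2)[OF m(1)] sub by (auto simp: y'_def shift_on_def)
  ultimately show thesis using that[OF 1 2] by blast
qed

lemma stuck_optimal:
  assumes inv: "loop_invariant a v x" and stuck: "\<nexists>x'. push_step E a v x x'"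
  shows "optimal (subtree E v) E a x"
proof -
  have "l1_dist (subtree E v) x a \<le> l1_dist (subtree E v) y a" if "feasible (subtree E v) E y" for y
    using that
  proof (induction "card {w \<in> subtree E v. x w \<noteq> y w}" arbitrary: y rule: less_induct)
    case less
    show ?case
    proof (cases "y v < x v")
      case True
      obtain y' where y': "feasible (subtree E v) E y'"
        "l1_dist (subtree E v) y' a \<le> l1_dist (subtree E v) y a"
        "{w \<in> subtree E v. x w \<noteq> y' w} \<subset> {w \<in> subtree E v. x w \<noteq> y w}"
        by (rule raise_towards_stuck[OF inv stuck less.prems True])
      have "finite {w \<in> subtree E v. x w \<noteq> y w}" by (simp add: finite_subtree)
      then have "l1_dist (subtree E v) x a \<le> l1_dist (subtree E v) y' a"
        using less.hyps y'(1,3) psubset_card_mono by blast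
      then show ?thesis using y'(2) by simp
    next
      \<comment> \<open>Here \<open>a v \<le> x v \<le> y v\<close>, so \<open>y\<close> gains
        nothing at the root and hence nothing at all.\<close>
      case False
      then show ?thesis
        using gain_le_root_gain[of v a x y] inv less.prems by (auto simp: loop_invariant_def)
    qed
  qed
  then show ?thesis using inv by (simp add: optimal_def loop_invariant_def)
qed

section \<open>From one vertex to the whole execution\<close>

text \<open>Initializing \<open>x v\<close> affects neither the child subtrees nor the child sum at
  \<open>v\<close>, so it establishes the loop invariant. The second conclusion protects processed
  subtrees elsewhere.\<close>

lemma process_vertex_optimal:
  assumes "process_vertex E a v x x'"
    and opt: "\<And>c. c \<in> children E v \<Longrightarrow> optimal (subtree E c) E a x"
  shows "optimal (subtree E v) E a x'" and "\<And>w. w \<notin> subtree E v \<Longrightarrow> x' w = x w"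
proof -
  define x1 where "x1 = x(v := max (child_sum E x v) (a v))"
  have steps: "(push_step E a v)\<^sup>*\<^sup>* x1 x'" and stuck: "\<nexists>x''. push_step E a v x' x''"
    using assms(1) by (auto simp: process_vertex_def x1_def)
  have opt1: "optimal (subtree E c) E a x1" if "c \<in> children E v" for c
  proof (rule optimal_subtree_cong[OF _ opt[OF that]])
    show "x w = x1 w" if "w \<in> subtree E c" for w
      using that not_in_child_subtree[OF \<open>c \<in> children E v\<close>] by (auto simp: x1_def)
  qed
  have "child_sum E x1 v = child_sum E x v"
    using not_child_of_descendant[OF self_in_subtree]
    by (intro child_sum_cong) (auto simp: x1_def)
  then have root: "child_sum E x1 v \<le> x1 v" by (simp add: x1_def)
  have "child_sum E x1 w \<le> x1 w" if "w \<in> subtree E v" for w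
  proof (cases "w = v")
    case False
    moreover have "w \<in> insert v (\<Union>c\<in>children E v. subtree E c)"
      using that by (simp flip: subtree_unfold)
    ultimately obtain c where c: "c \<in> children E v" "w \<in> subtree E c" by blast
    then show ?thesis using opt1[OF c(1)] by (simp add: optimal_def feasible_def)
  qed (simp add: root)
  then have "feasible (subtree E v) E x1" by (rule feasible_subtreeI)
  moreover have "a v \<le> x1 v" by (simp add: x1_def)
  ultimately have "loop_invariant a v x1" using opt1 by (simp add: loop_invariant_def)
  with steps have "loop_invariant a v x'"
    by induction (auto intro: push_step_invariant)
  then show "optimal (subtree E v) E a x'" using stuck by (rule stuck_optimal)
  show "x' w = x w" if "w \<notin> subtree E v" for w
  proof -
    from steps have "x' w = x1 w" by induction (use that in \<open>auto dest: push_step_outside\<close>)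
    then show ?thesis using that self_in_subtree[of v E] by (auto simp: x1_def)
  qed
qed

text \<open>
  Optimality is tracked only for the roots of the maximal processed subtrees: pushes at \<open>v\<close> may
  destroy the optimality of subtrees that lie deeper than the children of \<open>v\<close>.
\<close>

definition roots_optimal :: "('v \<Rightarrow> real) \<Rightarrow> 'v set \<Rightarrow> ('v \<Rightarrow> real) \<Rightarrow> bool" where
  "roots_optimal a S x \<longleftrightarrow>
    (\<forall>c\<in>S. (\<forall>u. (u, c) \<in> E \<longrightarrow> u \<notin> S) \<longrightarrow> optimal (subtree E c) E a x)"

lemma process_vertex_roots_optimal:
  assumes "process_vertex E a v x x'" and "roots_optimal a S x"
    and closed: "\<And>u. u \<in> S \<Longrightarrow> children E u \<subseteq> S"
    and v: "v \<notin> S" "children E v \<subseteq> S"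
  shows "roots_optimal a (insert v S) x'"
  unfolding roots_optimal_def
proof (intro ballI impI)
  have sub: "subtree E u \<subseteq> S" if "u \<in> S" for u
  proof
    fix w assume "w \<in> subtree E u"
    then have "(u, w) \<in> E\<^sup>*" by (simp add: subtree_def)
    then show "w \<in> S" using that closed by induction (auto simp: children_def)
  qed
  have "optimal (subtree E c) E a x" if "c \<in> children E v" for c
  proof -
    \<comment> \<open>The only parent of \<open>c\<close> is the unprocessed \<open>v\<close>, so
      \<open>c\<close> is still a root of the processed set.\<close>
    have "\<forall>u. (u, c) \<in> E \<longrightarrow> u \<notin> S"
      using that v(1) unique_parent unfolding children_def by blast
    then show ?thesis using assms(2) that v by (auto simp: roots_optimal_def)
  qed
  note new = process_vertex_optimal[OF assms(1) this]
  fix c assume c: "c \<in> insert v S" and root: "\<forall>u. (u, c) \<in> E \<longrightarrow> u \<notin> insert v S"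
  show "optimal (subtree E c) E a x'"
  proof (cases "c = v")
    case True
    then show ?thesis using new(1) by simp
  next
    case False
    then have "c \<in> S" using c by simp
    then have "v \<notin> subtree E c" using sub v by blast
    \<comment> \<open>Below \<open>v\<close>, the vertex \<open>c\<close> would have a processed
      parent and would not be a root.\<close>
    moreover have "c \<notin> subtree E v"
    proof
      assume cv: "c \<in> subtree E v"
      then obtain u where u: "(u, c) \<in> E"
        using False rtranclE[of v c E] by (auto simp: subtree_def)
      then have "u \<in> subtree E v" using parent_in_subtree cv False by blast
      moreover have "subtree E v \<subseteq> insert v S"
        using sub v(2) by (subst subtree_unfold) blast
      ultimately show False using root u by blast
    qed
    ultimately have "subtree E c \<inter> subtree E v = {}" using subtrees_nested by blast
    then have "x w = x' w" if "w \<in> subtree E c" for w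
      using new(2) that by (metis disjoint_iff)
    moreover have "optimal (subtree E c) E a x"
      using assms(2) \<open>c \<in> S\<close> root by (auto simp: roots_optimal_def)
    ultimately show ?thesis by (rule optimal_subtree_cong)
  qed
qed

text \<open>The list \<open>us\<close> holds the vertices already processed; the induction appends
  the current vertex to it.\<close>

lemma push_improve_roots_optimal:
  assumes "push_improve E a ws x z" "post_order V E (us @ ws)" "E \<subseteq> V \<times> V"
    and "roots_optimal a (set us) x"
  shows "roots_optimal a V z"
  using assms
proof (induction arbitrary: us rule: push_improve.induct)
  case (Nil x)
  then show ?case by (simp add: post_order_def)
next
  case (Cons v x y ws z)
  \<comment> \<open>Children precede parents in the enumeration, so \<open>us\<close> is closed
    under children and contains those of \<open>v\<close>.\<close>
  have before: "w \<in> set (take i (us @ v # ws))"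
    if "(us @ v # ws) ! i = u" "i < length (us @ v # ws)" "w \<in> children E u" for i u w
  proof -
    have "w \<in> set (us @ v # ws)"
      using that Cons.prems(1,2) by (auto simp: children_def post_order_def)
    then obtain j where "j < length (us @ v # ws)" "(us @ v # ws) ! j = w"
      by (metis in_set_conv_nth)
    moreover from this have "j < i"
      using that Cons.prems(1) by (auto simp: children_def post_order_def)
    ultimately show ?thesis using that by (auto simp: in_set_conv_nth simp del: take_append intro!: exI[of _ j])
  qed
  have "children E u \<subseteq> set us" if u: "u \<in> set us" for u
  proof
    fix w assume w: "w \<in> children E u"
    obtain i where i: "i < length us" "us ! i = u" using u by (auto simp: in_set_conv_nth)
    then have "w \<in> set (take i us)" using before[of i u w] w by (simp add: nth_append)
    then show "w \<in> set us" by (rule in_set_takeD)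
  qed
  moreover have "children E v \<subseteq> set us" using before[of "length us" v] by auto
  moreover have "v \<notin> set us" using Cons.prems(1) by (auto simp: post_order_def)
  ultimately have "roots_optimal a (insert v (set us)) y"
    using process_vertex_roots_optimal[OF Cons.hyps(1) Cons.prems(3)] by blast
  then show ?case using Cons.IH[of "us @ [v]"] Cons.prems by simp
qed

end

text \<open>Edges lead to strictly earlier list positions, so the position, unique by distinctness,
  is a measure for the converse relation.\<close>

lemma post_order_acyclic:
  assumes "post_order V E vs" "E \<subseteq> V \<times> V"
  shows "acyclic E"
proof -
  have "wf (E\<inverse>)"
  proof (rule wf_subset)
    show "E\<inverse> \<subseteq> measure (\<lambda>v. THE i. i < length vs \<and> vs ! i = v)"
    proof
      fix e assume "e \<in> E\<inverse>"
      then obtain u w where e: "e = (w, u)" "(u, w) \<in> E" by auto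
      then have "u \<in> set vs" "w \<in> set vs" using assms by (auto simp: post_order_def)
      then obtain i j where ij: "i < length vs" "vs ! i = u" "j < length vs" "vs ! j = w"
        by (metis in_set_conv_nth)
      have "(THE i. i < length vs \<and> vs ! i = vs ! n) = n" if "n < length vs" for n
        using assms(1) that by (auto simp: post_order_def nth_eq_iff_index_eq)
      then show "e \<in> measure (\<lambda>v. THE i. i < length vs \<and> vs ! i = v)"
        using ij e assms(1) by (auto simp: post_order_def)
    qed
  qed simp
  then show ?thesis using wf_acyclic by force
qed

theorem theorem1:
  fixes V :: "'v set" and E :: "('v \<times> 'v) set" and r :: 'v
    and a x0 x :: "'v \<Rightarrow> real" and vs :: "'v list"
  assumes "rooted_tree V E r"
    and "\<forall>v\<in>V. 0 \<le> a v"
    and "post_order V E vs"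
    and "push_improve E a vs x0 x"
  shows "optimal V E a x"
proof -
  have tree: "finite V" "r \<in> V" "E \<subseteq> V \<times> V" "\<And>u. (u, r) \<notin> E"
    "\<And>v. v \<in> V - {r} \<Longrightarrow> \<exists>!u. (u, v) \<in> E" "\<And>v. v \<in> V \<Longrightarrow> (r, v) \<in> E\<^sup>*"
    using assms(1) by (auto simp: rooted_tree_def)
  interpret finite_forest E
  proof
    show "finite E" using tree(1,3) by (meson finite_SigmaI finite_subset)
    show "acyclic E" using post_order_acyclic assms(3) tree(3) by blast
    show "u = u'" if "(u, w) \<in> E" "(u', w) \<in> E" for u u' w
      using that tree(3,4) tree(5)[of w] by blast
  qed
  have "subtree E r \<subseteq> V"
  proof
    fix w assume "w \<in> subtree E r"
    then have "(r, w) \<in> E\<^sup>*" by (simp add: subtree_def)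
    then show "w \<in> V" by (cases rule: rtranclE) (use tree(2,3) in auto)
  qed
  then have "subtree E r = V" using tree(6) by (auto simp: subtree_def)
  \<comment> \<open>Nothing is processed at the start, so the invariant holds vacuously for every
    \<open>x0\<close>.\<close>
  moreover have "roots_optimal a V x"
    using push_improve_roots_optimal[of a vs x0 x V "[]"] assms(3,4) tree(3)
    by (simp add: roots_optimal_def)
  \<comment> \<open>Since \<open>r\<close> has no parent, it is a root of the processed set
    \<open>V\<close>.\<close>
  ultimately show ?thesis using tree(2,4) by (auto simp: roots_optimal_def)
qed

end
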